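(* Let $\mathcal{S}\subseteq\mathbb{Z}^2$ be a finite shape, and let $\mathcal{A}$ be a doubly periodic $\mathcal{S}$-DDC of density $\delta$. Then there exists a set of at least $\lceil\delta|\mathcal{S}|\rceil$ dots contained in $\mathcal{S}$ that form a DDC.
   Context: A shape is a set of positions of the square grid $\mathbb{Z}^2$; $(i,j)+\mathcal{S}=\{(i+i',j+j'):(i',j')\in\mathcal{S}\}$. An array of dots $\mathcal{A}\subseteq\mathbb{Z}^2$ is doubly periodic with period $(\eta,\kappa)$ ($\eta,\kappa$ positive integers) if $(i,j)$ is a dot iff $(i+\eta,j)$ is a dot iff $(i,j+\kappa)$ is a dot, for all $i,j$; its density is $d/(\eta\kappa)$, where $d$ is the number of dots in any set $\{(i_0+i,j_0+j):0\le i\le\eta-1,0\le j\le\kappa-1\}$. A set of dots is a DDC if the vectors $x-y$, over ordered pairs $(x,y)$ of distinct dots, are pairwise distinct. $\mathcal{A}$ is a doubly periodic $\mathcal{S}$-DDC if it is doubly periodic and the dots contained in every shift $(i,j)+\mathcal{S}$ form a DDC. *)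

theory Defs
  imports Complex_Main "HOL-Library.Product_Plus"
begin

type_synonym position = "int \<times> int"

definition shift :: "position \<Rightarrow> position set \<Rightarrow> position set" where
  "shift v S = (\<lambda>x. v + x) ` S"

definition doubly_periodic :: "int \<Rightarrow> int \<Rightarrow> position set \<Rightarrow> bool" where
  "doubly_periodic \<eta> \<kappa> A \<longleftrightarrow> 0 < \<eta> \<and> 0 < \<kappa> \<and>
     (\<forall>i j. ((i, j) \<in> A \<longleftrightarrow> (i + \<eta>, j) \<in> A) \<and> ((i, j) \<in> A \<longleftrightarrow> (i, j + \<kappa>) \<in> A))"

definition window :: "int \<Rightarrow> int \<Rightarrow> position \<Rightarrow> position set" where
  "window \<eta> \<kappa> v = shift v ({0..\<eta> - 1} \<times> {0..\<kappa> - 1})"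

text \<open>The dots are counted in the window based at the origin; by \<open>card_dots_window\<close> and
  \<open>dot_density_window\<close> below, any other base point gives the same value.\<close>

definition dot_density :: "int \<Rightarrow> int \<Rightarrow> position set \<Rightarrow> real" where
  "dot_density \<eta> \<kappa> A = real (card (A \<inter> window \<eta> \<kappa> (0, 0))) / (of_int \<eta> * of_int \<kappa>)"

definition is_DDC :: "position set \<Rightarrow> bool" where
  "is_DDC D \<longleftrightarrow> inj_on (\<lambda>(x, y). x - y) {(x, y). x \<in> D \<and> y \<in> D \<and> x \<noteq> y}"

definition doubly_periodic_S_DDC :: "position set \<Rightarrow> int \<Rightarrow> int \<Rightarrow> position set \<Rightarrow> bool" where
  "doubly_periodic_S_DDC S \<eta> \<kappa> A \<longleftrightarrow>
     doubly_periodic \<eta> \<kappa> A \<and> (\<forall>v. is_DDC (A \<inter> shift v S))"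

lemma periodic_shift_multiple:
  fixes P :: "int \<Rightarrow> bool"
  assumes "\<And>i. P i \<longleftrightarrow> P (i + p)"
  shows "P (i + k * p) \<longleftrightarrow> P i"
proof (induction k rule: int_induct[where k = 0])
  case base
  show ?case by simp
next
  case (step1 k)
  have "i + (k + 1) * p = i + k * p + p" by (simp add: distrib_right)
  then show ?case using step1.IH assms[of "i + k * p"] by metis
next
  case (step2 k)
  have "i + k * p = i + (k - 1) * p + p" by (simp add: left_diff_distrib)
  then show ?case using step2.IH assms[of "i + (k - 1) * p"] by metis
qed

lemma doubly_periodic_mod:
  assumes "doubly_periodic \<eta> \<kappa> A"
  shows "(i mod \<eta>, j mod \<kappa>) \<in> A \<longleftrightarrow> (i, j) \<in> A"
proof -
  have per: "(i, j) \<in> A \<longleftrightarrow> (i + \<eta>, j) \<in> A" "(i, j) \<in> A \<longleftrightarrow> (i, j + \<kappa>) \<in> A" for i j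
    using iffD1[OF doubly_periodic_def assms] by iprover+
  have "(i mod \<eta> + (i div \<eta>) * \<eta>, j mod \<kappa>) \<in> A \<longleftrightarrow> (i mod \<eta>, j mod \<kappa>) \<in> A"
    by (rule periodic_shift_multiple[where P = "\<lambda>i. (i, j mod \<kappa>) \<in> A"]) (rule per(1))
  moreover have "(i, j mod \<kappa> + (j div \<kappa>) * \<kappa>) \<in> A \<longleftrightarrow> (i, j mod \<kappa>) \<in> A"
    by (rule periodic_shift_multiple[where P = "\<lambda>j. (i, j) \<in> A"]) (rule per(2))
  ultimately show ?thesis by simp
qed

lemma mem_window_iff:
  "(i, j) \<in> window \<eta> \<kappa> (a, b) \<longleftrightarrow> a \<le> i \<and> i < a + \<eta> \<and> b \<le> j \<and> j < b + \<kappa>"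
proof
  assume "a \<le> i \<and> i < a + \<eta> \<and> b \<le> j \<and> j < b + \<kappa>"
  then have "(i - a, j - b) \<in> {0..\<eta> - 1} \<times> {0..\<kappa> - 1}" by auto
  then have "(a, b) + (i - a, j - b) \<in> window \<eta> \<kappa> (a, b)"
    unfolding window_def shift_def by (rule imageI)
  then show "(i, j) \<in> window \<eta> \<kappa> (a, b)" by simp
qed (auto simp: window_def shift_def)

lemma mod_shift_mod:
  fixes a x p :: int
  assumes "a \<le> x" "x < a + p"
  shows "a + (x mod p - a) mod p = x"
proof -
  have "(x mod p - a) mod p = (x - a) mod p" by (simp add: mod_diff_left_eq)
  also have "\<dots> = x - a" using assms by (intro mod_pos_pos_trivial) auto
  finally show ?thesis by simp
qed

lemma shift_mod_mod:
  fixes a x p :: int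
  assumes "0 \<le> x" "x < p"
  shows "(a + (x - a) mod p) mod p = x"
  using assms by (simp add: mod_add_right_eq)

lemma card_dots_window:
  assumes "doubly_periodic \<eta> \<kappa> A"
  shows "card (A \<inter> window \<eta> \<kappa> v) = card (A \<inter> window \<eta> \<kappa> (0, 0))"
proof -
  obtain a b where v: "v = (a, b)" by (cases v)
  have pos: "0 < \<eta>" "0 < \<kappa>" using iffD1[OF doubly_periodic_def assms] by iprover+
  have "bij_betw (\<lambda>(i, j). (i mod \<eta>, j mod \<kappa>))
          (A \<inter> window \<eta> \<kappa> v) (A \<inter> window \<eta> \<kappa> (0, 0))"
  proof (rule bij_betw_byWitness
      [where f' = "\<lambda>(i, j). (a + (i - a) mod \<eta>, b + (j - b) mod \<kappa>)"])
    show "(\<lambda>(i, j). (a + (i - a) mod \<eta>, b + (j - b) mod \<kappa>)) ` (A \<inter> window \<eta> \<kappa> (0, 0))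
            \<subseteq> A \<inter> window \<eta> \<kappa> v"
    proof clarify
      fix i j
      assume ij: "(i, j) \<in> A" "(i, j) \<in> window \<eta> \<kappa> (0, 0)"
      let ?i = "a + (i - a) mod \<eta>" and ?j = "b + (j - b) mod \<kappa>"
      have "?i mod \<eta> = i" "?j mod \<kappa> = j"
        using ij(2) by (simp_all add: mem_window_iff shift_mod_mod)
      then have "(?i, ?j) \<in> A" using doubly_periodic_mod[OF assms, of ?i ?j] ij(1) by simp
      then show "(?i, ?j) \<in> A \<inter> window \<eta> \<kappa> v" using pos by (simp add: v mem_window_iff)
    qed
  qed (use pos in \<open>auto simp: v mem_window_iff mod_shift_mod shift_mod_mod
      doubly_periodic_mod[OF assms]\<close>)
  then show ?thesis by (rule bij_betw_same_card)
qed

lemma dot_density_window: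
  assumes "doubly_periodic \<eta> \<kappa> A"
  shows "dot_density \<eta> \<kappa> A = real (card (A \<inter> window \<eta> \<kappa> v)) / (of_int \<eta> * of_int \<kappa>)"
  by (simp only: dot_density_def card_dots_window[OF assms, of v])

end

theory Submission
  imports Defs
begin

text \<open>Averaging: as the base point \<open>v\<close> runs over one period, each \<open>s \<in> S\<close> is a dot of the array
  translated by \<open>-v\<close> exactly as often as there are dots in a period. Hence the average number
  of dots in \<open>shift v S\<close> is \<open>\<delta> * card S\<close>, some \<open>v\<close> attains it, and the dots in \<open>shift v S\<close>
  translated back by \<open>v\<close> form a DDC.\<close>

lemma card_window:
  assumes "0 \<le> \<eta>" "0 \<le> \<kappa>"
  shows "card (window \<eta> \<kappa> v) = nat \<eta> * nat \<kappa>"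
  unfolding window_def shift_def
  by (subst card_image) (simp_all add: card_cartesian_product)

lemma finite_window: "finite (window \<eta> \<kappa> v)"
  by (simp add: window_def shift_def)

lemma window_eq_shift: "window \<eta> \<kappa> v = shift v (window \<eta> \<kappa> (0, 0))"
  by (simp add: window_def shift_def image_image flip: zero_prod_def)

text \<open>Adding \<open>v\<close> to both dots of a pair cancels in \<open>x - y\<close>, so the
  difference map is only precomposed with an injection \<open>?f\<close> on pairs.\<close>

lemma is_DDC_shift_iff: "is_DDC (shift v D) \<longleftrightarrow> is_DDC D"
proof -
  let ?P = "\<lambda>D :: position set. {(x, y). x \<in> D \<and> y \<in> D \<and> x \<noteq> y}"
  let ?f = "\<lambda>(x, y). (v + x, v + y)"
  have inj: "inj_on ?f (?P D)"
    by (auto simp: inj_on_def)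
  have "?P (shift v D) = ?f ` ?P D"
    by (cases v) (auto simp: shift_def image_iff)
  then have "is_DDC (shift v D) \<longleftrightarrow> inj_on ((\<lambda>(x, y). x - y) \<circ> ?f) (?P D)"
    by (simp only: is_DDC_def comp_inj_on_iff[OF inj])
  also have "(\<lambda>(x, y). x - y) \<circ> ?f = (\<lambda>(x, y). x - y)"
    by (simp add: fun_eq_iff)
  finally show ?thesis
    by (simp only: is_DDC_def)
qed

text \<open>Pulls the dots in a translate back into the shape itself. It serves twice: with a window
  as the shape, for counting, and with the given shape, for the DDC.\<close>

lemma Int_shift_eq: "A \<inter> shift v S = shift v {s \<in> S. v + s \<in> A}"
  by (auto simp: shift_def)

text \<open>Translation by \<open>s\<close> carries these positions onto the dots in the window
  based at \<open>s\<close>, and all windows hold equally many dots.\<close>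

lemma card_translates_in_array:
  assumes "doubly_periodic \<eta> \<kappa> A"
  shows "card {v \<in> window \<eta> \<kappa> (0, 0). v + s \<in> A} = card (A \<inter> window \<eta> \<kappa> (0, 0))"
proof -
  have "A \<inter> window \<eta> \<kappa> s = (+) s ` {v \<in> window \<eta> \<kappa> (0, 0). v + s \<in> A}"
    unfolding window_eq_shift[of _ _ s] Int_shift_eq by (simp add: shift_def add.commute)
  then have "card (A \<inter> window \<eta> \<kappa> s) = card {v \<in> window \<eta> \<kappa> (0, 0). v + s \<in> A}"
    by (simp add: card_image)
  then show ?thesis
    using card_dots_window[OF assms, of s] by simp
qed

text \<open>Double counting of the pairs \<open>(v, s)\<close> with \<open>v + s \<in> A\<close>:
  grouped by \<open>v\<close> on the left, by \<open>s\<close> on the right.\<close>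

lemma sum_card_dots_in_shift:
  assumes "finite S" "doubly_periodic \<eta> \<kappa> A"
  shows "(\<Sum>v \<in> window \<eta> \<kappa> (0, 0). card {s \<in> S. v + s \<in> A})
    = card S * card (A \<inter> window \<eta> \<kappa> (0, 0))"
  using sum_multicount_gen[OF finite_window assms(1), of \<eta> \<kappa> "(0, 0)" "\<lambda>v s. v + s \<in> A"
      "\<lambda>_. card (A \<inter> window \<eta> \<kappa> (0, 0))"]
  by (simp add: card_translates_in_array[OF assms(2)])

theorem theorem18:
  fixes S A :: "position set" and \<eta> \<kappa> :: int and \<delta> :: real
  assumes "finite S"
    and "doubly_periodic_S_DDC S \<eta> \<kappa> A"
    and "\<delta> = dot_density \<eta> \<kappa> A"
  shows "\<exists>D. D \<subseteq> S \<and> is_DDC D \<and> \<lceil>\<delta> * real (card S)\<rceil> \<le> int (card D)"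
proof -
  let ?W = "window \<eta> \<kappa> (0, 0)"
  let ?D = "\<lambda>v. {s \<in> S. v + s \<in> A}"
  have per: "doubly_periodic \<eta> \<kappa> A" and ddc: "\<And>v. is_DDC (A \<inter> shift v S)"
    using assms(2) by (auto simp: doubly_periodic_S_DDC_def)
  have pos: "0 < \<eta>" "0 < \<kappa>"
    using per by (auto simp: doubly_periodic_def)
  have cW: "real (card ?W) = of_int \<eta> * of_int \<kappa>"
    using pos by (simp add: card_window)
  have "\<exists>v \<in> ?W. \<delta> * real (card S) \<le> real (card (?D v))"
  proof (rule ccontr)
    assume "\<not> ?thesis"
    then have lt: "real (card (?D v)) < \<delta> * real (card S)" if "v \<in> ?W" for v
      using that by force
    \<comment> \<open>Strictness of the summed inequality needs at least one term.\<close>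
    have "?W \<noteq> {}"
      using cW pos by auto
    then have "(\<Sum>v \<in> ?W. real (card (?D v))) < (\<Sum>v \<in> ?W. \<delta> * real (card S))"
      by (intro sum_strict_mono finite_window lt)
    \<comment> \<open>The number \<open>card ?W\<close> of equal terms cancels the denominator of
      the density.\<close>
    also have "\<dots> = real (card S * card (A \<inter> ?W))"
      using pos by (simp add: cW assms(3) dot_density_def)
    also have "\<dots> = (\<Sum>v \<in> ?W. real (card (?D v)))"
      by (simp only: sum_card_dots_in_shift[OF assms(1) per, symmetric] of_nat_sum)
    finally show False by simp
  qed
  then obtain v where "\<delta> * real (card S) \<le> real (card (?D v))" by blast
  then have "\<lceil>\<delta> * real (card S)\<rceil> \<le> int (card (?D v))"
    by (simp add: ceiling_le_iff)
  moreover have "is_DDC (?D v)"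
    using ddc[of v] by (simp add: Int_shift_eq is_DDC_shift_iff)
  ultimately show ?thesis by (intro exI[of _ "?D v"]) simp
qed

end
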